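(* Suppose $(P,Q,R)$ satisfies the system associated to the generalised Chazy equation with parameter $k=4$: $$P'=\tfrac16(P^2-Q),\qquad Q'=\tfrac23(PQ-R),\qquad R'=PR+\tfrac45Q^2.$$ Then the following holds. The triple $$\left(P-\lambda,\;-\frac{5}{3}Q-5\lambda^2-\frac{10}{3}\nu^2,\;-\frac{5}{3}Q\nu-\frac{20}{27}R-7Q\lambda-8\frac{Q^2}{R}\lambda^2-\frac{8}{135}\frac{Q^3}{R}\right)$$ also satisfies the same system (parameter $k=4$), where $\nu$ is a root of the cubic equation $$\nu^3+\frac{3}{5}Q\nu-\frac{1}{5}R=0$$ and $\lambda=\frac{1}{3}\nu+\frac{4}{15\nu}Q$ satisfies $$\lambda^3-\frac{4}{5}\frac{Q^2}{R}\lambda^2-\frac{Q}{5}\lambda-\frac{4}{675}\frac{Q^3}{R}-\frac{1}{135}R=0.$$ Furthermore, let $$\chi=-\frac{R}{2Q}\pm\frac{1}{2}\sqrt{\frac{R^2}{Q^2}+\frac{4}{5}Q}.$$ Then (for either choice of sign) the triple $$(p,q,r)=\left(P-\chi,\;-\frac{3}{5}Q-3\chi^2,\;-\frac{3}{5}R-\frac{9}{5}Q\chi-3\chi^3\right)$$ satisfies the system associated to the generalised Chazy equation with parameter $k=3$, i.e. $p'=\frac16(p^2-q)$, $q'=\frac23(pq-r)$, $r'=pr+\frac13q^2$.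
   Context: The first order system associated to the generalised Chazy equation with parameter $k$, for functions $P,Q,R$ of $x$ (with $'=d/dx$), is $$P'=\tfrac16(P^2-Q),\qquad Q'=\tfrac23(PQ-R),\qquad R'=PR+\frac{k^2}{36-k^2}Q^2;$$ a triple "satisfies the system with parameter $k$" if its first, second and third entries satisfy these equations in the roles of $P,Q,R$. Quantities introduced as roots of polynomial equations, or through square roots, are differentiable functions of $x$ (branches) satisfying the defining relations identically in $x$, and all statements are understood where the displayed denominators are nonzero. *)

theory Defs
  imports "HOL-Analysis.Analysis"
begin

text \<open>
  Taking \<open>'a = real\<close> gives the system for functions of a real variable, \<open>'a = complex\<close> the
  holomorphic one: the derivative is that of the field \<open>'a\<close>. The definition is only meaningful for
  \<open>S\<close> open and \<open>k\<^sup>2 \<noteq> 36\<close>.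
\<close>

definition chazy_system ::
  "'a::real_normed_field \<Rightarrow> 'a set \<Rightarrow> ('a \<Rightarrow> 'a) \<Rightarrow> ('a \<Rightarrow> 'a) \<Rightarrow> ('a \<Rightarrow> 'a) \<Rightarrow> bool" where
  "chazy_system k S P Q R \<longleftrightarrow>
    (\<forall>x\<in>S.
      (P has_field_derivative (1/6) * ((P x)^2 - Q x)) (at x) \<and>
      (Q has_field_derivative (2/3) * (P x * Q x - R x)) (at x) \<and>
      (R has_field_derivative P x * R x + k^2 / (36 - k^2) * (Q x)^2) (at x))"

end

theory Submission
  imports Defs
begin

text \<open>
  Both transformations subtract from \<open>P\<close> a rational expression in \<open>Q\<close> and a root of a polynomial whose
  coefficients are polynomials in \<open>Q\<close> and \<open>R\<close>. What makes them work is that the root itself satisfies a Riccati equation: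
  \<open>\<nu>' = (P\<nu> + 2\<nu>\<^sup>2 + 4Q/5)/3\<close> for the cubic (\<open>cubic_root_DERIV\<close>), and
  \<open>\<chi>' = (P\<chi> - 2\<chi>\<^sup>2 - 4Q/5)/3\<close> for the quadratic \<open>Q\<chi>\<^sup>2 + R\<chi> = Q\<^sup>2/5\<close>, whose roots are the two
  branches \<open>\<chi>\<close> (\<open>quadratic_root_DERIV\<close>). Once these are known, the new systems are polynomial
  identities. For the cubic case they become so in the parameters \<open>m = \<nu>/3\<close> and \<open>v = Q/(15\<nu>)\<close>: then
  \<open>\<lambda> = m + 4v\<close>, \<open>Q = 45mv\<close>, \<open>R = 135m\<^sup>2(m + 3v)\<close>, and all quotients by \<open>R\<close> in the transformed triple
  combine to a polynomial (\<open>chazy4_of_cubic_parameters\<close>, \<open>chazy4_cubic_transform\<close>).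

  Implicit differentiation gives the Riccati equations where the root is simple. Up to a constant
  factor, both discriminants equal \<open>D = R\<^sup>2 + 4Q\<^sup>3/5\<close>, and the system gives
  \<open>D' = 2PD\<close>. By uniqueness for linear equations, a zero of \<open>D\<close> therefore forces \<open>D = 0\<close> in a
  whole neighbourhood (\<open>chazy4_discriminant_zero_propagates\<close>). Hence a branch \<open>y\<close> that is a double root at
  one point is a double root nearby, so that \<open>Q = -5y\<^sup>2\<close> there, and differentiating this relation
  yields the same Riccati equation.
\<close>

section \<open>Linear differential equations and differentiation rules\<close>

text \<open>
  Local uniqueness for \<open>f' = g f\<close>, by a contraction argument: on a ball of radius \<open>r\<close> where
  \<open>\<bar>g\<bar> \<le> M\<close> and \<open>M r \<le> 1/2\<close>, the mean value inequality turns any bound for \<open>\<bar>f\<bar>\<close> into half of it.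
  This avoids compactness and integration, and so works in every normed field over the reals.
\<close>

lemma zero_propagates_linear_ode:
  fixes f g :: "'a::real_normed_field \<Rightarrow> 'a"
  assumes "open S" and "x0 \<in> S"
    and der: "\<And>x. x \<in> S \<Longrightarrow> (f has_field_derivative g x * f x) (at x)"
    and cont: "isCont g x0"
    and zero: "f x0 = 0"
  shows "\<forall>\<^sub>F x in nhds x0. f x = 0"
proof -
  define M where "M = norm (g x0) + 1"
  have "M > 0"
    by (simp add: M_def add_nonneg_pos)
  have "((\<lambda>x. norm (g x)) \<longlongrightarrow> norm (g x0)) (nhds x0)"
    using cont by (simp add: tendsto_norm tendsto_at_iff_tendsto_nhds isCont_def)
  then have g_bound: "\<forall>\<^sub>F x in nhds x0. norm (g x) < M"
    by (rule order_tendstoD) (simp add: M_def)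
  have "isCont f x0"
    using der[OF \<open>x0 \<in> S\<close>] by (rule DERIV_isCont)
  then have "((\<lambda>x. norm (f x)) \<longlongrightarrow> norm (f x0)) (nhds x0)"
    by (simp add: tendsto_norm tendsto_at_iff_tendsto_nhds isCont_def)
  then have f_bound: "\<forall>\<^sub>F x in nhds x0. norm (f x) < 1"
    by (rule order_tendstoD) (simp add: zero)
  have "\<forall>\<^sub>F x in nhds x0. x \<in> S"
    using assms(1,2) by (rule eventually_nhds_in_open)
  with g_bound f_bound have "\<forall>\<^sub>F x in nhds x0. norm (g x) < M \<and> norm (f x) < 1 \<and> x \<in> S"
    by eventually_elim simp
  then obtain e where "e > 0"
    and e: "\<And>x. dist x x0 < e \<Longrightarrow> norm (g x) < M \<and> norm (f x) < 1 \<and> x \<in> S"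
    unfolding eventually_nhds_metric by blast
  define r where "r = min e (1 / (2 * M))"
  have "r > 0"
    using \<open>e > 0\<close> \<open>M > 0\<close> by (simp add: r_def)
  have near: "norm (g x) < M \<and> norm (f x) < 1 \<and> x \<in> S" if "x \<in> ball x0 r" for x
    using that e[of x] by (simp add: r_def dist_commute)
  have small: "norm (f y) \<le> (1/2) ^ n" if "y \<in> ball x0 r" for y n
    using that
  proof (induction n arbitrary: y)
    case 0
    then show ?case
      using near[of y] by simp
  next
    case (Suc n)
    have "norm (f y - f x0) \<le> (M * (1/2) ^ n) * norm (y - x0)"
    proof (rule field_differentiable_bound[OF convex_ball])
      fix z assume z: "z \<in> ball x0 r"
      then show "(f has_field_derivative g z * f z) (at z within ball x0 r)"
        using near der has_field_derivative_at_within by blast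
      show "norm (g z * f z) \<le> M * (1/2) ^ n"
        unfolding norm_mult
        using near[OF z] Suc.IH[OF z] \<open>M > 0\<close> by (intro mult_mono) auto
    qed (use Suc.prems \<open>r > 0\<close> in auto)
    also have "\<dots> \<le> (M * (1/2) ^ n) * (1 / (2 * M))"
      using Suc.prems \<open>M > 0\<close>
      by (intro mult_left_mono) (auto simp: r_def dist_norm norm_minus_commute)
    also have "\<dots> = (1/2) ^ Suc n"
      using \<open>M > 0\<close> by simp
    finally show ?case
      by (simp add: zero)
  qed
  have "f y = 0" if "y \<in> ball x0 r" for y
  proof -
    have "(\<lambda>n. (1/2 :: real) ^ n) \<longlonglongrightarrow> 0"
      by (rule LIMSEQ_power_zero) simp
    then have "norm (f y) \<le> 0"
      by (rule LIMSEQ_le_const) (use small[OF that] in blast)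
    then show ?thesis
      by simp
  qed
  then show ?thesis
    using \<open>r > 0\<close> unfolding eventually_nhds_metric by (metis dist_commute mem_ball)
qed

lemma DERIV_square:
  fixes f :: "'a::real_normed_field \<Rightarrow> 'a"
  assumes "(f has_field_derivative D) (at x)"
  shows "((\<lambda>y. (f y)^2) has_field_derivative 2 * f x * D) (at x)"
  using DERIV_power[OF assms, of 2] by (simp add: mult_ac)

lemma DERIV_cube:
  fixes f :: "'a::real_normed_field \<Rightarrow> 'a"
  assumes "(f has_field_derivative D) (at x)"
  shows "((\<lambda>y. (f y)^3) has_field_derivative 3 * (f x)^2 * D) (at x)"
  using DERIV_power[OF assms, of 3] by (simp add: mult_ac)

text \<open>
  These rules come before the general ones so that derivatives of polynomials are produced without
  \<open>of_nat\<close> and without derivatives of constants; what remains is a ring identity.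
\<close>

lemmas polynomial_DERIV_intros = DERIV_square DERIV_cube DERIV_cmult DERIV_cdivide derivative_intros

section \<open>The system with parameter 4 and its discriminant\<close>

lemma chazy_systemD:
  assumes "chazy_system k S P Q R" and "x \<in> S"
  shows "(P has_field_derivative (1/6) * ((P x)^2 - Q x)) (at x)"
    and "(Q has_field_derivative (2/3) * (P x * Q x - R x)) (at x)"
    and "(R has_field_derivative P x * R x + k^2 / (36 - k^2) * (Q x)^2) (at x)"
  using assms by (auto simp: chazy_system_def)

lemma chazy_system_transform:
  assumes "open S" and sys: "chazy_system k S P Q R"
    and eq: "\<And>x. x \<in> S \<Longrightarrow> P x = P' x"
      "\<And>x. x \<in> S \<Longrightarrow> Q x = Q' x"
      "\<And>x. x \<in> S \<Longrightarrow> R x = R' x"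
  shows "chazy_system k S P' Q' R'"
  unfolding chazy_system_def
proof (intro ballI)
  fix x assume x: "x \<in> S"
  note transform = has_field_derivative_transform_within_open[OF _ \<open>open S\<close> x]
  show "(P' has_field_derivative 1/6 * ((P' x)^2 - Q' x)) (at x) \<and>
      (Q' has_field_derivative 2/3 * (P' x * Q' x - R' x)) (at x) \<and>
      (R' has_field_derivative P' x * R' x + k^2 / (36 - k^2) * (Q' x)^2) (at x)"
    using chazy_systemD[OF sys x, THEN transform] eq unfolding eq[OF x] by blast
qed

text \<open>
  \<open>R\<^sup>2 + 4Q\<^sup>3/5\<close> is a Darboux polynomial of the system with cofactor \<open>2P\<close>: along a solution it
  satisfies a homogeneous linear equation.
\<close>

lemma chazy4_discriminant_zero_propagates:
  fixes P Q R :: "'a::real_normed_field \<Rightarrow> 'a"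
  assumes "open S" and sys: "chazy_system 4 S P Q R" and "x \<in> S"
    and zero: "(R x)^2 + 4/5 * (Q x)^3 = 0"
  shows "\<forall>\<^sub>F y in nhds x. (R y)^2 + 4/5 * (Q y)^3 = 0"
proof (rule zero_propagates_linear_ode)
  show "((\<lambda>y. (R y)^2 + 4/5 * (Q y)^3) has_field_derivative
      (2 * P y) * ((R y)^2 + 4/5 * (Q y)^3)) (at y)" if "y \<in> S" for y
    by (rule DERIV_cong, (rule chazy_systemD[OF sys that] polynomial_DERIV_intros)+, algebra)
  show "isCont (\<lambda>y. 2 * P y) x"
    using DERIV_isCont[OF chazy_systemD(1)[OF sys \<open>x \<in> S\<close>]] by (intro continuous_intros)
qed (use assms in auto)

lemma DERIV_unique_eventually_zero:
  assumes "(f has_field_derivative D) (at x)" and "\<forall>\<^sub>F y in nhds x. f y = 0"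
  shows "D = 0"
proof -
  have "((\<lambda>y. 0) has_field_derivative D) (at x)"
    using assms by (subst DERIV_cong_ev[OF refl _ refl, symmetric]) auto
  then show ?thesis
    using DERIV_const DERIV_unique by blast
qed

section \<open>Riccati equations for the algebraic branches\<close>

text \<open>
  The derivative of the cubic in its unknown is \<open>3(5\<nu>\<^sup>2 + Q)/5\<close>, and after substituting
  \<open>R = 5\<nu>\<^sup>3 + 3Q\<nu>\<close> the factor \<open>5\<nu>\<^sup>2 + Q\<close> divides the derivative of the whole relation. If
  \<open>5\<nu>\<^sup>2 + Q\<close> vanishes at \<open>x\<close>, then so does \<open>5D = (5\<nu>\<^sup>2 + Q)\<^sup>2(5\<nu>\<^sup>2 + 4Q)\<close>, hence \<open>D\<close> vanishes near \<open>x\<close>;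
  as \<open>\<nu> x \<noteq> 0\<close> separates the double root from the simple one, \<open>\<nu>\<close> stays on the double root.
\<close>

lemma cubic_root_DERIV:
  fixes P Q R \<nu> :: "'a::real_normed_field \<Rightarrow> 'a"
  assumes "open S" and sys: "chazy_system 4 S P Q R" and "x \<in> S"
    and diff: "\<nu> field_differentiable (at x)"
    and root: "\<And>y. y \<in> S \<Longrightarrow> (\<nu> y)^3 + 3/5 * Q y * \<nu> y - 1/5 * R y = 0"
    and nz: "\<nu> x \<noteq> 0"
  shows "(\<nu> has_field_derivative (P x * \<nu> x + 2 * (\<nu> x)^2 + 4/5 * Q x) / 3) (at x)"
proof -
  obtain d where d: "(\<nu> has_field_derivative d) (at x)"
    using diff by (auto simp: field_differentiable_def)
  note der = chazy_systemD[OF sys \<open>x \<in> S\<close>]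
  have R_eq: "R y = 5 * (\<nu> y)^3 + 3 * Q y * \<nu> y" if "y \<in> S" for y
    using root[OF that] by algebra
  have in_S: "\<forall>\<^sub>F y in nhds x. y \<in> S"
    using \<open>open S\<close> \<open>x \<in> S\<close> by (rule eventually_nhds_in_open)
  have disc: "5 * ((R y)^2 + 4/5 * (Q y)^3) = (5 * (\<nu> y)^2 + Q y)^2 * (5 * (\<nu> y)^2 + 4 * Q y)"
    if "y \<in> S" for y
    using R_eq[OF that] by algebra
  have "d = (P x * \<nu> x + 2 * (\<nu> x)^2 + 4/5 * Q x) / 3"
  proof (cases "5 * (\<nu> x)^2 + Q x = 0")
    case False
    have "((\<lambda>y. (\<nu> y)^3 + 3/5 * Q y * \<nu> y - 1/5 * R y) has_field_derivative
        3/5 * (5 * (\<nu> x)^2 + Q x) * (d - (P x * \<nu> x + 2 * (\<nu> x)^2 + 4/5 * Q x) / 3)) (at x)"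
      by (rule DERIV_cong, (rule d der polynomial_DERIV_intros)+)
        (use R_eq[OF \<open>x \<in> S\<close>] in algebra)
    then have "3/5 * (5 * (\<nu> x)^2 + Q x) * (d - (P x * \<nu> x + 2 * (\<nu> x)^2 + 4/5 * Q x) / 3) = 0"
      by (rule DERIV_unique_eventually_zero) (rule eventually_mono[OF in_S root])
    then have "(5 * (\<nu> x)^2 + Q x) * (d - (P x * \<nu> x + 2 * (\<nu> x)^2 + 4/5 * Q x) / 3) = 0"
      by algebra
    with False show ?thesis
      by (simp only: mult_eq_0_iff right_minus_eq) simp
  next
    case True
    have "(R x)^2 + 4/5 * (Q x)^3 = 0"
      using disc[OF \<open>x \<in> S\<close>] True by algebra
    then have D0: "\<forall>\<^sub>F y in nhds x. (R y)^2 + 4/5 * (Q y)^3 = 0"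
      by (rule chazy4_discriminant_zero_propagates[OF \<open>open S\<close> sys \<open>x \<in> S\<close>])
    have Qx: "Q x = - (5 * (\<nu> x)^2)"
      using True by (simp add: add_eq_0_iff)
    \<comment> \<open>The simple root has \<open>5\<nu>\<^sup>2 + 4Q = 0\<close>, but here this expression is \<open>-15\<nu>\<^sup>2\<close> at \<open>x\<close>.\<close>
    have "isCont (\<lambda>y. 5 * (\<nu> y)^2 + 4 * Q y) x"
      by (intro continuous_intros DERIV_isCont[OF d] DERIV_isCont[OF der(2)])
    then have "((\<lambda>y. 5 * (\<nu> y)^2 + 4 * Q y) \<longlongrightarrow> 5 * (\<nu> x)^2 + 4 * Q x) (nhds x)"
      unfolding isCont_def by (rule iffD1[OF tendsto_at_iff_tendsto_nhds])
    then have "\<forall>\<^sub>F y in nhds x. 5 * (\<nu> y)^2 + 4 * Q y \<noteq> 0"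
      by (rule tendsto_imp_eventually_ne) (simp add: Qx nz)
    with D0 in_S have "\<forall>\<^sub>F y in nhds x. 5 * (\<nu> y)^2 + Q y = 0"
    proof eventually_elim
      case (elim y)
      have "(5 * (\<nu> y)^2 + Q y)^2 * (5 * (\<nu> y)^2 + 4 * Q y) = 0"
        unfolding disc[OF elim(2), symmetric] elim(1) by simp
      with elim(3) show ?case
        by simp
    qed
    moreover have "((\<lambda>y. 5 * (\<nu> y)^2 + Q y) has_field_derivative
        10 * \<nu> x * (d - (P x * \<nu> x + 2 * (\<nu> x)^2 + 4/5 * Q x) / 3)) (at x)"
      by (rule DERIV_cong, (rule d der polynomial_DERIV_intros)+)
        (use R_eq[OF \<open>x \<in> S\<close>] Qx in algebra)
    ultimately have "10 * \<nu> x * (d - (P x * \<nu> x + 2 * (\<nu> x)^2 + 4/5 * Q x) / 3) = 0"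
      using DERIV_unique_eventually_zero by blast
    with nz show ?thesis
      by simp
  qed
  with d show ?thesis
    by simp
qed

text \<open>
  As for the cubic, with \<open>D = (2Q\<chi> + R)\<^sup>2\<close>. A quadratic with vanishing discriminant has only the double
  root, so \<open>\<chi>\<close> stays on it wherever \<open>D = 0\<close>.
\<close>

lemma quadratic_root_DERIV:
  fixes P Q R chi :: "'a::real_normed_field \<Rightarrow> 'a"
  assumes "open S" and sys: "chazy_system 4 S P Q R" and "x \<in> S"
    and diff: "chi field_differentiable (at x)"
    and root: "\<And>y. y \<in> S \<Longrightarrow> Q y * (chi y)^2 + R y * chi y - (Q y)^2 / 5 = 0"
    and nz: "\<And>y. y \<in> S \<Longrightarrow> Q y \<noteq> 0"
  shows "(chi has_field_derivative (P x * chi x - 2 * (chi x)^2 - 4/5 * Q x) / 3) (at x)"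
proof -
  obtain d where d: "(chi has_field_derivative d) (at x)"
    using diff by (auto simp: field_differentiable_def)
  note der = chazy_systemD[OF sys \<open>x \<in> S\<close>]
  have in_S: "\<forall>\<^sub>F y in nhds x. y \<in> S"
    using \<open>open S\<close> \<open>x \<in> S\<close> by (rule eventually_nhds_in_open)
  have disc: "(R y)^2 + 4/5 * (Q y)^3 = (2 * Q y * chi y + R y)^2" if "y \<in> S" for y
    using root[OF that] by algebra
  have "d = (P x * chi x - 2 * (chi x)^2 - 4/5 * Q x) / 3"
  proof (cases "2 * Q x * chi x + R x = 0")
    case False
    \<comment> \<open>The relation reappears, with cofactor \<open>4(P - \<chi>)/3\<close>, in its own derivative along the system.\<close>
    let ?e = "d - (P x * chi x - 2 * (chi x)^2 - 4/5 * Q x) / 3"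
    have "((\<lambda>y. Q y * (chi y)^2 + R y * chi y - (Q y)^2 / 5) has_field_derivative
        (2 * Q x * chi x + R x) * ?e
        + (4/3 * P x - 4/3 * chi x) * (Q x * (chi x)^2 + R x * chi x - (Q x)^2 / 5)) (at x)"
      by (rule DERIV_cong, (rule d der polynomial_DERIV_intros)+, algebra)
    then have "(2 * Q x * chi x + R x) * ?e = 0"
      unfolding root[OF \<open>x \<in> S\<close>] mult_zero_right add_0_right
      by (rule DERIV_unique_eventually_zero) (rule eventually_mono[OF in_S root])
    with False show ?thesis
      by simp
  next
    case True
    have double: "Q y = - (5 * (chi y)^2)" if "y \<in> S" and "2 * Q y * chi y + R y = 0" for y
    proof -
      have "Q y * (Q y + 5 * (chi y)^2) = 0"
        using root[OF that(1)] that(2) by algebra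
      with nz[OF that(1)] show ?thesis
        by (simp add: add_eq_0_iff2)
    qed
    have "(R x)^2 + 4/5 * (Q x)^3 = 0"
      using disc[OF \<open>x \<in> S\<close>] True by simp
    then have "\<forall>\<^sub>F y in nhds x. (R y)^2 + 4/5 * (Q y)^3 = 0"
      by (rule chazy4_discriminant_zero_propagates[OF \<open>open S\<close> sys \<open>x \<in> S\<close>])
    with in_S have "\<forall>\<^sub>F y in nhds x. 5 * (chi y)^2 + Q y = 0"
    proof eventually_elim
      case (elim y)
      then show ?case using disc[of y] double[of y] by simp
    qed
    moreover have "((\<lambda>y. 5 * (chi y)^2 + Q y) has_field_derivative
        10 * chi x * (d - (P x * chi x - 2 * (chi x)^2 - 4/5 * Q x) / 3)) (at x)"
      by (rule DERIV_cong, (rule d der polynomial_DERIV_intros)+)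
        (use True double[OF \<open>x \<in> S\<close> True] in algebra)
    ultimately have "10 * chi x * (d - (P x * chi x - 2 * (chi x)^2 - 4/5 * Q x) / 3) = 0"
      using DERIV_unique_eventually_zero by blast
    moreover have "chi x \<noteq> 0"
      using nz[OF \<open>x \<in> S\<close>] double[OF \<open>x \<in> S\<close> True] by auto
    ultimately show ?thesis
      by simp
  qed
  with d show ?thesis
    by simp
qed

section \<open>The transformed systems\<close>

text \<open>
  The parameters \<open>m = \<nu>/3\<close> and \<open>v = Q/(15\<nu>)\<close> make \<open>(P, m, v)\<close> a polynomial differential system, and the
  transformed triple is polynomial in them with integer coefficients.
\<close>

lemma chazy4_of_cubic_parameters:
  fixes P m v :: "'a::real_normed_field \<Rightarrow> 'a"
  assumes P': "\<And>x. x \<in> S \<Longrightarrow> (P has_field_derivative 1/6 * ((P x)^2 - 45 * m x * v x)) (at x)"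
    and m': "\<And>x. x \<in> S \<Longrightarrow>
      (m has_field_derivative P x * m x / 3 + 2 * (m x)^2 + 4 * m x * v x) (at x)"
    and v': "\<And>x. x \<in> S \<Longrightarrow>
      (v has_field_derivative P x * v x / 3 - 2 * (m x)^2 - 8 * m x * v x - 4 * (v x)^2) (at x)"
  shows "chazy_system 4 S
    (\<lambda>x. P x - m x - 4 * v x)
    (\<lambda>x. - 35 * (m x)^2 - 115 * m x * v x - 80 * (v x)^2)
    (\<lambda>x. - 100 * (m x)^3 - 840 * (m x)^2 * v x - 1380 * m x * (v x)^2 - 640 * (v x)^3)"
  unfolding chazy_system_def
proof (intro ballI conjI)
  fix x assume "x \<in> S"
  note der = P'[OF this] m'[OF this] v'[OF this]
  let ?p = "P x - m x - 4 * v x"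
  let ?q = "- 35 * (m x)^2 - 115 * m x * v x - 80 * (v x)^2"
  let ?r = "- 100 * (m x)^3 - 840 * (m x)^2 * v x - 1380 * m x * (v x)^2 - 640 * (v x)^3"
  show "((\<lambda>x. P x - m x - 4 * v x) has_field_derivative 1/6 * (?p^2 - ?q)) (at x)"
    by (rule DERIV_cong, (rule der polynomial_DERIV_intros)+, algebra)
  show "((\<lambda>x. - 35 * (m x)^2 - 115 * m x * v x - 80 * (v x)^2) has_field_derivative
      2/3 * (?p * ?q - ?r)) (at x)"
    by (rule DERIV_cong, (rule der polynomial_DERIV_intros)+, algebra)
  show "((\<lambda>x. - 100 * (m x)^3 - 840 * (m x)^2 * v x - 1380 * m x * (v x)^2 - 640 * (v x)^3)
      has_field_derivative ?p * ?r + 4\<^sup>2 / (36 - 4\<^sup>2) * ?q^2) (at x)"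
    by (rule DERIV_cong, (rule der polynomial_DERIV_intros)+, algebra)
qed

text \<open>
  Rewriting in \<open>m\<close> and \<open>v\<close> removes all denominators: the relation for \<open>\<lambda>\<close> and the third component
  contain the same combination of \<open>Q\<^sup>2/R\<close> and \<open>Q\<^sup>3/R\<close>, in which
  \<open>3(m + 4v)\<^sup>2 + mv = (m + 3v)(3m + 16v)\<close> absorbs the factor \<open>m + 3v\<close> of \<open>R\<close>.
\<close>

lemma chazy4_cubic_transform:
  fixes P Q R \<nu> lam :: "'a::real_normed_field \<Rightarrow> 'a"
  assumes "open S" and sys: "chazy_system 4 S P Q R"
    and diff: "\<And>x. x \<in> S \<Longrightarrow> \<nu> field_differentiable (at x)"
    and root: "\<And>x. x \<in> S \<Longrightarrow> (\<nu> x)^3 + 3/5 * Q x * \<nu> x - 1/5 * R x = 0"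
    and nz: "\<And>x. x \<in> S \<Longrightarrow> R x \<noteq> 0 \<and> \<nu> x \<noteq> 0"
    and lam: "\<And>x. x \<in> S \<Longrightarrow> lam x = 1/3 * \<nu> x + 4 / (15 * \<nu> x) * Q x"
  shows "x \<in> S \<Longrightarrow> (lam x)^3 - 4/5 * ((Q x)^2 / R x) * (lam x)^2 - Q x / 5 * lam x
      - 4/675 * ((Q x)^3 / R x) - 1/135 * R x = 0" (is "_ \<Longrightarrow> ?cubic")
    and "chazy_system 4 S
      (\<lambda>x. P x - lam x)
      (\<lambda>x. - (5/3) * Q x - 5 * (lam x)^2 - 10/3 * (\<nu> x)^2)
      (\<lambda>x. - (5/3) * Q x * \<nu> x - 20/27 * R x - 7 * Q x * lam x
             - 8 * ((Q x)^2 / R x) * (lam x)^2 - 8/135 * ((Q x)^3 / R x))"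
proof -
  define m where "m x = \<nu> x / 3" for x
  define v where "v x = Q x / (15 * \<nu> x)" for x
  have \<nu>_eq: "\<nu> x = 3 * m x" for x
    by (simp add: m_def)
  have lam_eq: "lam x = m x + 4 * v x" if "x \<in> S" for x
    using lam[OF that] by (simp add: m_def v_def)
  have Q_eq: "Q x = 45 * m x * v x" if "x \<in> S" for x
    using nz[OF that] by (simp add: m_def v_def)
  have R_eq: "R x = 135 * (m x)^2 * (m x + 3 * v x)" if "x \<in> S" for x
    using root[OF that] unfolding Q_eq[OF that] \<nu>_eq by algebra
  have nz': "m x \<noteq> 0" "m x + 3 * v x \<noteq> 0" if "x \<in> S" for x
    using nz[OF that] R_eq[OF that] by auto
  \<comment> \<open>\<open>c\<close> carries the denominator \<open>m + 3v\<close> of the quotients by \<open>R\<close>; it cancels in \<open>tail\<close> below.\<close>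
  define c where "c x = (v x)^2 / (m x + 3 * v x)" for x
  have c_eq: "c x * (m x + 3 * v x) = (v x)^2" if "x \<in> S" for x
    using nz'[OF that] by (simp add: c_def)
  have Q2R: "(Q x)^2 / R x = 15 * c x" and Q3R: "(Q x)^3 / R x = 675 * m x * v x * c x"
    if "x \<in> S" for x
  proof -
    have "(Q x)^2 = 15 * c x * R x" "(Q x)^3 = 675 * m x * v x * c x * R x"
      using c_eq[OF that] Q_eq[OF that] R_eq[OF that] by algebra+
    then show "(Q x)^2 / R x = 15 * c x" "(Q x)^3 / R x = 675 * m x * v x * c x"
      using nz[OF that] by simp_all
  qed
  have tail: "4/5 * ((Q x)^2 / R x) * (lam x)^2 + 4/675 * ((Q x)^3 / R x)
      = 4 * (v x)^2 * (3 * m x + 16 * v x)" if "x \<in> S" for x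
    unfolding Q2R[OF that] Q3R[OF that] lam_eq[OF that] using c_eq[OF that] by algebra
  show ?cubic if "x \<in> S"
  proof -
    have "(lam x)^3 - Q x / 5 * lam x - 1/135 * R x = 4 * (v x)^2 * (3 * m x + 16 * v x)"
      unfolding Q_eq[OF that] R_eq[OF that] lam_eq[OF that]
      by algebra
    with tail[OF that] show ?thesis
      by (simp add: algebra_simps)
  qed
  have third: "- (5/3) * Q x * \<nu> x - 20/27 * R x - 7 * Q x * lam x
        - 8 * ((Q x)^2 / R x) * (lam x)^2 - 8/135 * ((Q x)^3 / R x)
      = - 100 * (m x)^3 - 840 * (m x)^2 * v x - 1380 * m x * (v x)^2 - 640 * (v x)^3"
    if "x \<in> S" for x
  proof -
    have "- (5/3) * Q x * \<nu> x - 20/27 * R x - 7 * Q x * lam x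
        - 8 * ((Q x)^2 / R x) * (lam x)^2 - 8/135 * ((Q x)^3 / R x)
      = - (5/3) * Q x * \<nu> x - 20/27 * R x - 7 * Q x * lam x
        - 10 * (4/5 * ((Q x)^2 / R x) * (lam x)^2 + 4/675 * ((Q x)^3 / R x))"
      by (simp add: algebra_simps)
    then show ?thesis
      unfolding tail[OF that] unfolding \<nu>_eq Q_eq[OF that] R_eq[OF that] lam_eq[OF that]
      by algebra
  qed
  have "chazy_system 4 S
    (\<lambda>x. P x - m x - 4 * v x)
    (\<lambda>x. - 35 * (m x)^2 - 115 * m x * v x - 80 * (v x)^2)
    (\<lambda>x. - 100 * (m x)^3 - 840 * (m x)^2 * v x - 1380 * m x * (v x)^2 - 640 * (v x)^3)"
  proof (rule chazy4_of_cubic_parameters)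
    fix x assume x: "x \<in> S"
    note der = chazy_systemD[OF sys x]
    show "(P has_field_derivative 1/6 * ((P x)^2 - 45 * m x * v x)) (at x)"
      using der(1) by (simp add: Q_eq[OF x])
    have \<nu>': "(\<nu> has_field_derivative (P x * \<nu> x + 2 * (\<nu> x)^2 + 4/5 * Q x) / 3) (at x)"
      using nz[OF x] by (intro cubic_root_DERIV[OF \<open>open S\<close> sys x diff[OF x] root]) auto
    have "(m has_field_derivative (P x * \<nu> x + 2 * (\<nu> x)^2 + 4/5 * Q x) / 3 / 3) (at x)"
      unfolding m_def[abs_def] by (intro DERIV_cdivide \<nu>')
    also have "(P x * \<nu> x + 2 * (\<nu> x)^2 + 4/5 * Q x) / 3 / 3
        = P x * m x / 3 + 2 * (m x)^2 + 4 * m x * v x"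
      unfolding \<nu>_eq Q_eq[OF x] by algebra
    finally show "(m has_field_derivative P x * m x / 3 + 2 * (m x)^2 + 4 * m x * v x) (at x)" .
    have "(v has_field_derivative
        ((2/3 * (P x * Q x - R x)) * (15 * \<nu> x)
          - Q x * (15 * ((P x * \<nu> x + 2 * (\<nu> x)^2 + 4/5 * Q x) / 3)))
        / ((15 * \<nu> x) * (15 * \<nu> x))) (at x)"
      unfolding v_def[abs_def]
      using nz[OF x] by (intro DERIV_divide der(2) DERIV_cmult \<nu>') simp
    also have "((2/3 * (P x * Q x - R x)) * (15 * \<nu> x)
          - Q x * (15 * ((P x * \<nu> x + 2 * (\<nu> x)^2 + 4/5 * Q x) / 3)))
        / ((15 * \<nu> x) * (15 * \<nu> x))
        = P x * v x / 3 - 2 * (m x)^2 - 8 * m x * v x - 4 * (v x)^2"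
      using nz[OF x]
      by (simp add: divide_eq_eq) (use \<nu>_eq[of x] Q_eq[OF x] R_eq[OF x] in algebra)
    finally show "(v has_field_derivative
        P x * v x / 3 - 2 * (m x)^2 - 8 * m x * v x - 4 * (v x)^2) (at x)" .
  qed
  then show "chazy_system 4 S
      (\<lambda>x. P x - lam x)
      (\<lambda>x. - (5/3) * Q x - 5 * (lam x)^2 - 10/3 * (\<nu> x)^2)
      (\<lambda>x. - (5/3) * Q x * \<nu> x - 20/27 * R x - 7 * Q x * lam x
             - 8 * ((Q x)^2 / R x) * (lam x)^2 - 8/135 * ((Q x)^3 / R x))"
  proof (rule chazy_system_transform[OF \<open>open S\<close>])
    fix x assume x: "x \<in> S"
    show "P x - m x - 4 * v x = P x - lam x"
      by (simp add: lam_eq[OF x])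
    show "- 35 * (m x)^2 - 115 * m x * v x - 80 * (v x)^2
        = - (5/3) * Q x - 5 * (lam x)^2 - 10/3 * (\<nu> x)^2"
      unfolding \<nu>_eq lam_eq[OF x] Q_eq[OF x] by algebra
  qed (rule third[symmetric])
qed

text \<open>
  The Riccati equation for \<open>\<chi>\<close> settles the first two equations as identities in \<open>P, Q, R, \<chi>\<close>;
  the third holds up to \<open>3/5\<close> of the quadratic relation.
\<close>

lemma chazy3_of_chazy4:
  fixes P Q R chi :: "'a::real_normed_field \<Rightarrow> 'a"
  assumes "open S" and sys: "chazy_system 4 S P Q R"
    and diff: "\<And>x. x \<in> S \<Longrightarrow> chi field_differentiable (at x)"
    and root: "\<And>x. x \<in> S \<Longrightarrow> Q x * (chi x)^2 + R x * chi x - (Q x)^2 / 5 = 0"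
    and nz: "\<And>x. x \<in> S \<Longrightarrow> Q x \<noteq> 0"
  shows "chazy_system 3 S
    (\<lambda>x. P x - chi x)
    (\<lambda>x. - (3/5) * Q x - 3 * (chi x)^2)
    (\<lambda>x. - (3/5) * R x - 9/5 * Q x * chi x - 3 * (chi x)^3)"
  unfolding chazy_system_def
proof (intro ballI conjI)
  fix x assume x: "x \<in> S"
  have "(chi has_field_derivative (P x * chi x - 2 * (chi x)^2 - 4/5 * Q x) / 3) (at x)"
    by (rule quadratic_root_DERIV[OF \<open>open S\<close> sys x diff[OF x] root nz])
  note der = this chazy_systemD[OF sys x]
  let ?p = "P x - chi x"
  let ?q = "- (3/5) * Q x - 3 * (chi x)^2"
  let ?r = "- (3/5) * R x - 9/5 * Q x * chi x - 3 * (chi x)^3"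
  show "((\<lambda>x. P x - chi x) has_field_derivative 1/6 * (?p^2 - ?q)) (at x)"
    by (rule DERIV_cong, (rule der polynomial_DERIV_intros)+, algebra)
  show "((\<lambda>x. - (3/5) * Q x - 3 * (chi x)^2) has_field_derivative 2/3 * (?p * ?q - ?r)) (at x)"
    by (rule DERIV_cong, (rule der polynomial_DERIV_intros)+, algebra)
  have "((\<lambda>x. - (3/5) * R x - 9/5 * Q x * chi x - 3 * (chi x)^3) has_field_derivative
      ?p * ?r + 3^2 / (36 - 3^2) * ?q^2
        + 3/5 * (Q x * (chi x)^2 + R x * chi x - (Q x)^2 / 5)) (at x)"
    by (rule DERIV_cong, (rule der polynomial_DERIV_intros)+, algebra)
  then show "((\<lambda>x. - (3/5) * R x - 9/5 * Q x * chi x - 3 * (chi x)^3) has_field_derivative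
      ?p * ?r + 3^2 / (36 - 3^2) * ?q^2) (at x)"
    unfolding root[OF x] by simp
qed

section \<open>The two transformations together\<close>

text \<open>
  For \<open>\<chi> = -R/(2Q) \<plusminus> s/2\<close> the sign disappears in \<open>(2Q\<chi> + R)\<^sup>2 = Q\<^sup>2s\<^sup>2 = R\<^sup>2 + 4Q\<^sup>3/5\<close>, which
  is the quadratic relation for \<open>\<chi>\<close> with the square completed.
\<close>

theorem theorem5p1:
  fixes S :: "'a::real_normed_field set"
    and P Q R :: "'a \<Rightarrow> 'a"
  assumes "open S"
    and "chazy_system 4 S P Q R"
  shows
    "(\<forall>\<nu> lam :: 'a \<Rightarrow> 'a.
        (\<forall>x\<in>S. \<nu> field_differentiable (at x)) \<longrightarrow>
        (\<forall>x\<in>S. (\<nu> x)^3 + 3/5 * Q x * \<nu> x - 1/5 * R x = 0) \<longrightarrow>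
        (\<forall>x\<in>S. R x \<noteq> 0 \<and> \<nu> x \<noteq> 0) \<longrightarrow>
        (\<forall>x\<in>S. lam x = 1/3 * \<nu> x + 4 / (15 * \<nu> x) * Q x) \<longrightarrow>
          (\<forall>x\<in>S. (lam x)^3 - 4/5 * ((Q x)^2 / R x) * (lam x)^2 - Q x / 5 * lam x
                    - 4/675 * ((Q x)^3 / R x) - 1/135 * R x = 0) \<and>
          chazy_system 4 S
            (\<lambda>x. P x - lam x)
            (\<lambda>x. - (5/3) * Q x - 5 * (lam x)^2 - 10/3 * (\<nu> x)^2)
            (\<lambda>x. - (5/3) * Q x * \<nu> x - 20/27 * R x - 7 * Q x * lam x
                   - 8 * ((Q x)^2 / R x) * (lam x)^2 - 8/135 * ((Q x)^3 / R x))) \<and>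
     (\<forall>(s :: 'a \<Rightarrow> 'a) (\<sigma> :: 'a) (chi :: 'a \<Rightarrow> 'a).
        (\<forall>x\<in>S. Q x \<noteq> 0) \<longrightarrow>
        (\<forall>x\<in>S. s field_differentiable (at x)) \<longrightarrow>
        (\<forall>x\<in>S. (s x)^2 = (R x)^2 / (Q x)^2 + 4/5 * Q x) \<longrightarrow>
        \<sigma> \<in> {1, -1} \<longrightarrow>
        (\<forall>x\<in>S. chi x = - (R x / (2 * Q x)) + \<sigma> * (1/2) * s x) \<longrightarrow>
          chazy_system 3 S
            (\<lambda>x. P x - chi x)
            (\<lambda>x. - (3/5) * Q x - 3 * (chi x)^2)
            (\<lambda>x. - (3/5) * R x - 9/5 * Q x * chi x - 3 * (chi x)^3))"
proof (intro conjI allI impI)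
  fix \<nu> lam :: "'a \<Rightarrow> 'a"
  assume h: "\<forall>x\<in>S. \<nu> field_differentiable (at x)"
    "\<forall>x\<in>S. (\<nu> x)^3 + 3/5 * Q x * \<nu> x - 1/5 * R x = 0"
    "\<forall>x\<in>S. R x \<noteq> 0 \<and> \<nu> x \<noteq> 0"
    "\<forall>x\<in>S. lam x = 1/3 * \<nu> x + 4 / (15 * \<nu> x) * Q x"
  note transform = chazy4_cubic_transform[OF assms h[rule_format]]
  show "\<forall>x\<in>S. (lam x)^3 - 4/5 * ((Q x)^2 / R x) * (lam x)^2 - Q x / 5 * lam x
      - 4/675 * ((Q x)^3 / R x) - 1/135 * R x = 0"
    using transform(1) by blast
  show "chazy_system 4 S
      (\<lambda>x. P x - lam x)
      (\<lambda>x. - (5/3) * Q x - 5 * (lam x)^2 - 10/3 * (\<nu> x)^2)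
      (\<lambda>x. - (5/3) * Q x * \<nu> x - 20/27 * R x - 7 * Q x * lam x
             - 8 * ((Q x)^2 / R x) * (lam x)^2 - 8/135 * ((Q x)^3 / R x))"
    by (rule transform(2))
next
  fix s chi :: "'a \<Rightarrow> 'a" and \<sigma> :: 'a
  assume nz: "\<forall>x\<in>S. Q x \<noteq> 0"
    and s_diff: "\<forall>x\<in>S. s field_differentiable (at x)"
    and s_sq: "\<forall>x\<in>S. (s x)^2 = (R x)^2 / (Q x)^2 + 4/5 * Q x"
    and \<sigma>: "\<sigma> \<in> {1, -1}"
    and chi: "\<forall>x\<in>S. chi x = - (R x / (2 * Q x)) + \<sigma> * (1/2) * s x"
  show "chazy_system 3 S
      (\<lambda>x. P x - chi x)
      (\<lambda>x. - (3/5) * Q x - 3 * (chi x)^2)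
      (\<lambda>x. - (3/5) * R x - 9/5 * Q x * chi x - 3 * (chi x)^3)"
  proof (rule chazy3_of_chazy4[OF assms])
    fix x assume x: "x \<in> S"
    have "Q field_differentiable (at x)" "R field_differentiable (at x)" "s field_differentiable (at x)"
      using chazy_systemD[OF assms(2) x] s_diff x by (auto simp: field_differentiable_def)
    then have "(\<lambda>x. - (R x / (2 * Q x)) + \<sigma> * (1/2) * s x) field_differentiable (at x)"
      using nz x
      by (intro field_differentiable_add field_differentiable_minus field_differentiable_divide
          field_differentiable_mult field_differentiable_const) auto
    then obtain D where "((\<lambda>x. - (R x / (2 * Q x)) + \<sigma> * (1/2) * s x) has_field_derivative D) (at x)"
      by (auto simp: field_differentiable_def)
    then have "(chi has_field_derivative D) (at x)"
      by (rule has_field_derivative_transform_within_open[OF _ \<open>open S\<close> x]) (use chi in simp)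
    then show "chi field_differentiable (at x)"
      by (auto simp: field_differentiable_def)
    have "\<sigma>^2 = 1"
      using \<sigma> by auto
    have "2 * Q x * chi x + R x = \<sigma> * Q x * s x"
      using chi nz x by (simp add: field_simps)
    then have "(2 * Q x * chi x + R x)^2 = (Q x)^2 * (s x)^2"
      using \<open>\<sigma>^2 = 1\<close> by (simp add: power_mult_distrib)
    also have "\<dots> = (R x)^2 + 4/5 * (Q x)^3"
    proof -
      have "(Q x)^2 * ((R x)^2 / (Q x)^2) = (R x)^2"
        using nz x by simp
      then show ?thesis
        unfolding s_sq[rule_format, OF x] by algebra
    qed
    finally have "4 * Q x * (Q x * (chi x)^2 + R x * chi x - (Q x)^2 / 5) = 0"
      by algebra
    then show "Q x * (chi x)^2 + R x * chi x - (Q x)^2 / 5 = 0"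
      using nz x by simp
    show "Q x \<noteq> 0"
      using nz x by simp
  qed
qed

end
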